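(* For every integer $k\ge 0$, let $v_k=\sum_{\mu} a_k(\mu) f^{\mu}$, where the sum is over all integer partitions $\mu$. Then $v_k$ is the $k$-th Fubini number, that is, the number of ordered set partitions of $[k]$.
   Context: $[k]=\{1,2,\dots,k\}$. Integer partitions are identified with their Young diagrams and ordered by containment; $\emptyset$ is the only partition of $0$. $f^\mu$ is the number of standard Young tableaux of shape $\mu$, with $f^\emptyset=1$. A limiting vacillating tableau of shape $\mu$ and length $2k$ is a sequence of integer partitions $(\mu^{(0)}=\emptyset,\mu^{(1/2)},\mu^{(1)},\dots,\mu^{(k-1/2)},\mu^{(k)}=\mu)$ such that for each integer $j=0,\dots,k-1$: (a) $\mu^{(j)}\supseteq\mu^{(j+1/2)}$ and $|\mu^{(j)}/\mu^{(j+1/2)}|\in\{0,1\}$; (b) $\mu^{(j+1/2)}\subseteq\mu^{(j+1)}$ and $|\mu^{(j+1)}/\mu^{(j+1/2)}|=1$. $a_k(\mu)$ is the number of limiting vacillating tableaux of shape $\mu$ and length $2k$. An ordered set partition of a set $S$ is a partition of $S$ into disjoint non-empty blocks together with a linear order on the blocks (the empty set has exactly one). *)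

theory Defs
  imports Main "HOL-Library.FuncSet" "HOL-Library.Disjoint_Sets" "HOL-Analysis.Infinite_Sum"
begin

definition int_partition :: "nat list \<Rightarrow> bool" where
  "int_partition \<mu> \<longleftrightarrow> sorted_wrt (\<ge>) \<mu> \<and> (\<forall>m\<in>set \<mu>. 0 < m)"

text \<open>Cells are pairs (row, column), both counted from 0.\<close>

definition diagram :: "nat list \<Rightarrow> (nat \<times> nat) set" where
  "diagram \<mu> = {(i, j). i < length \<mu> \<and> j < \<mu> ! i}"

definition contained :: "nat list \<Rightarrow> nat list \<Rightarrow> bool" where
  "contained \<nu> \<mu> \<longleftrightarrow> diagram \<nu> \<subseteq> diagram \<mu>"

definition skew_size :: "nat list \<Rightarrow> nat list \<Rightarrow> nat" where
  "skew_size \<mu> \<nu> = card (diagram \<mu> - diagram \<nu>)"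

text \<open>Fillings are extensional functions, so that each tableau is counted exactly once.\<close>

definition standard_tableaux :: "nat list \<Rightarrow> (nat \<times> nat \<Rightarrow> nat) set" where
  "standard_tableaux \<mu> = {T \<in> extensional (diagram \<mu>).
     bij_betw T (diagram \<mu>) {1..sum_list \<mu>} \<and>
     (\<forall>i j j'. (i, j) \<in> diagram \<mu> \<and> (i, j') \<in> diagram \<mu> \<and> j < j' \<longrightarrow> T (i, j) < T (i, j')) \<and>
     (\<forall>i i' j. (i, j) \<in> diagram \<mu> \<and> (i', j) \<in> diagram \<mu> \<and> i < i' \<longrightarrow> T (i, j) < T (i', j))}"

definition num_SYT :: "nat list \<Rightarrow> nat" where
  "num_SYT \<mu> = card (standard_tableaux \<mu>)"

text \<open>
  The half-integer indices \<open>0, 1/2, 1, \<dots>, k\<close> are doubled: the list entry \<open>t ! (2 * j)\<close> is the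
  partition at time \<open>j\<close> and \<open>t ! (2 * j + 1)\<close> the one at time \<open>j + 1/2\<close>.
\<close>

definition limiting_vacillating_tableaux :: "nat \<Rightarrow> nat list \<Rightarrow> nat list list set" where
  "limiting_vacillating_tableaux k \<mu> = {t.
     length t = 2 * k + 1 \<and> (\<forall>\<nu>\<in>set t. int_partition \<nu>) \<and>
     t ! 0 = [] \<and> t ! (2 * k) = \<mu> \<and>
     (\<forall>j<k.
        contained (t ! (2 * j + 1)) (t ! (2 * j)) \<and>
        skew_size (t ! (2 * j)) (t ! (2 * j + 1)) \<in> {0, 1} \<and>
        contained (t ! (2 * j + 1)) (t ! (2 * j + 2)) \<and>
        skew_size (t ! (2 * j + 2)) (t ! (2 * j + 1)) = 1)}"

definition num_lvt :: "nat \<Rightarrow> nat list \<Rightarrow> nat" where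
  "num_lvt k \<mu> = card (limiting_vacillating_tableaux k \<mu>)"

text \<open>
  A sum over infinitely many partitions with only finitely many nonzero terms (the final shape of
  a tableau of length \<open>2 * k\<close> has size at most \<open>k\<close>).  An infinite support would make the
  sum \<open>0\<close> by convention.
\<close>

definition vac_sum :: "nat \<Rightarrow> nat" where
  "vac_sum k = (\<Sum>\<^sub>\<infinity>\<mu>\<in>{\<mu>. int_partition \<mu>}. num_lvt k \<mu> * num_SYT \<mu>)"

text \<open>The linear order on the blocks is the order in which the list enumerates them.\<close>

definition ordered_set_partitions :: "'a set \<Rightarrow> 'a set list set" where
  "ordered_set_partitions S = {Bs. distinct Bs \<and> partition_on S (set Bs)}"

definition fubini :: "nat \<Rightarrow> nat" where
  "fubini k = card (ordered_set_partitions {1..k})"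

end

theory Submission
  imports Defs "HOL-Combinatorics.Stirling"
begin

text \<open>
  Write \<open>f \<mu>\<close> for the number of standard tableaux of shape \<open>\<mu>\<close> and let \<open>A k n\<close> be the sum of
  \<open>f\<close> over the final shapes of all limiting vacillating tableaux of length \<open>2 * k\<close> whose final shape
  has size \<open>n\<close>.  The theorem holds because both sides split by a parameter \<open>n\<close> into the same
  summands, \<open>fact n * Stirling k n\<close>: on the left \<open>n\<close> is the size of the final shape, on the right it is
  the number of blocks.

  On the left, the weight \<open>f\<close> is an eigenvector of both half steps.  Summed over the diagrams obtained
  by deleting a cell of a non-empty \<open>\<mu>\<close>, it gives \<open>f \<mu>\<close>, since the largest entry of a tableau sits
  on a removable cell (\<open>card_linear_extensions_shrink\<close>).  Summed over the diagrams obtained by adding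
  a cell to \<open>\<mu>\<close>, it gives \<open>f \<mu>\<close> times the size of \<open>\<mu>\<close> plus one
  (\<open>card_linear_extensions_grow\<close>); this follows by induction from the branching rule and the
  commutation relation of Young's lattice (\<open>up_down_commutation\<close>).  A full step therefore either raises
  the size to \<open>n\<close> or keeps it at \<open>n\<close>, and multiplies the weight by \<open>n\<close> in both cases:
  \<open>A (k + 1) n = n * A k (n - 1) + n * A k n\<close> (\<open>weighted_lvts_of_size\<close>).

  On the right, ordered set partitions into \<open>n\<close> blocks are surjections onto an \<open>n\<close>-element set
  (\<open>ordered_set_partitions_eq_fibres\<close>), whose number satisfies the same recurrence
  (\<open>card_surjections\<close>).
\<close>

section \<open>Young diagrams as finite order ideals\<close>

text \<open>
  Lattice operations and covering relations are much simpler for sets of cells than for lists of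
  parts, so the combinatorics below takes place among finite order ideals of
  \<open>\<nat> \<times> \<nat>\<close>; \<open>diagram\<close> and \<open>partition_of\<close> translate between the two.
\<close>

definition young_diagram :: "(nat \<times> nat) set \<Rightarrow> bool" where
  "young_diagram D \<longleftrightarrow>
     finite D \<and> (\<forall>i j i' j'. (i, j) \<in> D \<longrightarrow> i' \<le> i \<longrightarrow> j' \<le> j \<longrightarrow> (i', j') \<in> D)"

definition row_length :: "(nat \<times> nat) set \<Rightarrow> nat \<Rightarrow> nat" where
  "row_length D i = card {j. (i, j) \<in> D}"

lemma young_diagram_finite: "young_diagram D \<Longrightarrow> finite D"
  by (simp add: young_diagram_def)

lemma young_diagram_down:
  "young_diagram D \<Longrightarrow> (i, j) \<in> D \<Longrightarrow> i' \<le> i \<Longrightarrow> j' \<le> j \<Longrightarrow> (i', j') \<in> D"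
  unfolding young_diagram_def by blast

lemma young_diagramI:
  assumes "finite D"
    and "\<And>i j i' j'. (i, j) \<in> D \<Longrightarrow> i' \<le> i \<Longrightarrow> j' \<le> j \<Longrightarrow> (i', j') \<in> D"
  shows "young_diagram D"
  using assms unfolding young_diagram_def by blast

lemma young_diagram_Un: "young_diagram D \<Longrightarrow> young_diagram E \<Longrightarrow> young_diagram (D \<union> E)"
  unfolding young_diagram_def by (simp; blast)

lemma young_diagram_Int: "young_diagram D \<Longrightarrow> young_diagram E \<Longrightarrow> young_diagram (D \<inter> E)"
  unfolding young_diagram_def by (simp; blast)

lemma finite_initial_segment_eq:
  fixes A :: "nat set"
  assumes "finite A" and down: "\<And>m n. n \<in> A \<Longrightarrow> m \<le> n \<Longrightarrow> m \<in> A"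
  shows "A = {..<card A}"
proof (cases "A = {}")
  case False
  then have "A = {..Max A}"
    using assms by (auto intro: down[OF Max_in])
  then show ?thesis
    by (metis card_atMost lessThan_Suc_atMost)
qed simp

lemma mem_iff_less_row_length:
  assumes "young_diagram D"
  shows "(i, j) \<in> D \<longleftrightarrow> j < row_length D i"
proof -
  have "{j. (i, j) \<in> D} \<subseteq> snd ` D"
    by force
  then have "finite {j. (i, j) \<in> D}"
    using young_diagram_finite[OF assms] finite_surj by blast
  then have "{j. (i, j) \<in> D} = {..<row_length D i}"
    unfolding row_length_def
    by (rule finite_initial_segment_eq) (use young_diagram_down[OF assms] in auto)
  then show ?thesis
    by blast
qed

lemma row_length_antimono:
  assumes "young_diagram D" and "i \<le> i'"
  shows "row_length D i' \<le> row_length D i"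
proof (rule ccontr)
  assume "\<not> ?thesis"
  then have "(i', row_length D i) \<in> D"
    by (simp add: mem_iff_less_row_length[OF assms(1)])
  then have "(i, row_length D i) \<in> D"
    using young_diagram_down[OF assms(1) _ assms(2)] by blast
  then show False
    by (simp add: mem_iff_less_row_length[OF assms(1)])
qed

text \<open>
  Row \<open>i\<close> is non-empty exactly if it meets column \<open>0\<close>, so the size of that column is the number of
  parts.
\<close>

definition partition_of :: "(nat \<times> nat) set \<Rightarrow> nat list" where
  "partition_of D = map (row_length D) [0..<card {i. (i, 0) \<in> D}]"

lemma int_partition_nth_antimono:
  "int_partition \<mu> \<Longrightarrow> i \<le> i' \<Longrightarrow> i' < length \<mu> \<Longrightarrow> \<mu> ! i' \<le> \<mu> ! i"
  unfolding int_partition_def by (cases "i = i'") (auto simp: sorted_wrt_iff_nth_less)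

lemma diagram_eq_Sigma: "diagram \<mu> = (SIGMA i:{..<length \<mu>}. {..<\<mu> ! i})"
  by (auto simp: diagram_def)

lemma finite_diagram: "finite (diagram \<mu>)"
  by (simp add: diagram_eq_Sigma)

lemma card_diagram: "card (diagram \<mu>) = sum_list \<mu>"
  by (simp add: diagram_eq_Sigma sum_list_sum_nth lessThan_atLeast0)

lemma young_diagram_diagram:
  assumes "int_partition \<mu>"
  shows "young_diagram (diagram \<mu>)"
  unfolding young_diagram_def
  using finite_diagram int_partition_nth_antimono[OF assms]
  by (fastforce simp: diagram_def)

lemma partition_of_diagram:
  assumes "int_partition \<mu>"
  shows "partition_of (diagram \<mu>) = \<mu>"
proof -
  have "{i. (i, 0) \<in> diagram \<mu>} = {..<length \<mu>}"
    using assms by (auto simp: diagram_def int_partition_def)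
  moreover have "row_length (diagram \<mu>) i = \<mu> ! i" if "i < length \<mu>" for i
    using that by (simp add: row_length_def diagram_def lessThan_def[symmetric])
  ultimately show ?thesis
    unfolding partition_of_def by (intro nth_equalityI) auto
qed

lemma first_column_eq:
  assumes "young_diagram D"
  shows "{i. (i, 0) \<in> D} = {..<card {i. (i, 0) \<in> D}}"
proof (rule finite_initial_segment_eq)
  have "{i. (i, 0) \<in> D} \<subseteq> fst ` D"
    by force
  then show "finite {i. (i, 0) \<in> D}"
    using young_diagram_finite[OF assms] finite_surj by blast
qed (use young_diagram_down[OF assms] in auto)

lemma partition_of_young_diagram:
  assumes "young_diagram D"
  shows "int_partition (partition_of D)" and "diagram (partition_of D) = D"
proof -
  have col: "i < card {i. (i, 0) \<in> D} \<longleftrightarrow> (i, 0) \<in> D" for i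
    using first_column_eq[OF assms] by blast
  have "0 < m" if "m \<in> set (partition_of D)" for m
    using that by (auto simp: partition_of_def col mem_iff_less_row_length[OF assms, symmetric])
  then show "int_partition (partition_of D)"
    by (auto simp: int_partition_def sorted_wrt_iff_nth_less partition_of_def
        intro!: row_length_antimono[OF assms])
  have "(i, j) \<in> diagram (partition_of D) \<longleftrightarrow> (i, j) \<in> D" for i j
  proof -
    have "(i, j) \<in> diagram (partition_of D) \<longleftrightarrow> (i, 0) \<in> D \<and> j < row_length D i"
      using col by (cases "i < card {i. (i, 0) \<in> D}") (simp_all add: diagram_def partition_of_def)
    then show ?thesis
      using young_diagram_down[OF assms, of i j i 0] mem_iff_less_row_length[OF assms, of i j]
      by auto
  qed
  then show "diagram (partition_of D) = D"
    by auto
qed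

lemma inj_on_diagram: "inj_on diagram {\<mu>. int_partition \<mu>}"
  by (rule inj_on_inverseI[of _ partition_of]) (simp add: partition_of_diagram)

text \<open>
  This is how sums over partitions become sums over diagrams.
\<close>

lemma bij_betw_diagram:
  assumes "\<And>\<mu>. int_partition \<mu> \<Longrightarrow> \<mu> \<in> A \<longleftrightarrow> diagram \<mu> \<in> B"
    and "\<And>\<mu>. \<mu> \<in> A \<Longrightarrow> int_partition \<mu>" and "\<And>D. D \<in> B \<Longrightarrow> young_diagram D"
  shows "bij_betw diagram A B"
proof (rule bij_betw_byWitness[where f' = partition_of])
  show "\<forall>\<mu>\<in>A. partition_of (diagram \<mu>) = \<mu>"
    using assms by (simp add: partition_of_diagram)
  show "\<forall>D\<in>B. diagram (partition_of D) = D"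
    using assms by (simp add: partition_of_young_diagram)
  show "diagram ` A \<subseteq> B"
    using assms by blast
  show "partition_of ` B \<subseteq> A"
    using assms partition_of_young_diagram by (metis image_subsetI)
qed

section \<open>The commutation relation in Young's lattice\<close>

definition upper_covers :: "(nat \<times> nat) set \<Rightarrow> (nat \<times> nat) set set" where
  "upper_covers D = {E. young_diagram E \<and> D \<subseteq> E \<and> card (E - D) = 1}"

definition lower_covers :: "(nat \<times> nat) set \<Rightarrow> (nat \<times> nat) set set" where
  "lower_covers D = {E. young_diagram E \<and> E \<subseteq> D \<and> card (D - E) = 1}"

text \<open>
  A cell can be added only at the end of a row, and then the row above has to be strictly longer; the
  top row has no such constraint.  Dually, by the next lemma, only the last cell of a row can be
  removed, and only if the row below is strictly shorter.
\<close>

lemma young_diagram_insert_iff: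
  assumes "young_diagram D" and "(i, j) \<notin> D"
  shows "young_diagram (insert (i, j) D) \<longleftrightarrow>
           j = row_length D i \<and> (i = 0 \<or> row_length D i < row_length D (i - 1))"
    (is "?L \<longleftrightarrow> ?R")
proof
  assume L: ?L
  note m = mem_iff_less_row_length[OF assms(1)]
  have "j \<le> row_length D i"
  proof (rule ccontr)
    assume gt: "\<not> j \<le> row_length D i"
    then have "(i, row_length D i) \<in> insert (i, j) D"
      using young_diagram_down[OF L, of i j i "row_length D i"] by simp
    then show False
      using gt by (auto simp: m)
  qed
  then have j: "j = row_length D i"
    using assms(2) m by force
  have "(i - 1, j) \<in> insert (i, j) D"
    using young_diagram_down[OF L, of i j "i - 1" j] by simp
  then show ?R
    using j m by (cases i) auto
next
  assume R: ?R
  note m = mem_iff_less_row_length[OF assms(1)]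
  have "(i', j') \<in> insert (i, j) D" if "i' \<le> i" "j' \<le> j" for i' j'
  proof (cases "i' = i")
    case True
    then show ?thesis using that R m by auto
  next
    case False
    then have "row_length D (i - 1) \<le> row_length D i'" "i \<noteq> 0"
      using that by (auto intro: row_length_antimono[OF assms(1)])
    then show ?thesis using that R m by auto
  qed
  then have down: "(i2, j2) \<in> insert (i, j) D" if "(i1, j1) \<in> insert (i, j) D" "i2 \<le> i1" "j2 \<le> j1"
    for i1 j1 i2 j2
    using that young_diagram_down[OF assms(1), of i1 j1 i2 j2] by auto
  show ?L
    by (rule young_diagramI[OF _ down]) (use young_diagram_finite[OF assms(1)] in simp_all)
qed

lemma young_diagram_remove_iff:
  assumes "young_diagram D" and "(i, j) \<in> D"
  shows "young_diagram (D - {(i, j)}) \<longleftrightarrow>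
           Suc j = row_length D i \<and> row_length D (Suc i) < row_length D i"
    (is "?L \<longleftrightarrow> ?R")
proof
  assume L: ?L
  note m = mem_iff_less_row_length[OF assms(1)]
  have "(i, Suc j) \<notin> D"
    using young_diagram_down[OF L, of i "Suc j" i j] by auto
  moreover have "(Suc i, j) \<notin> D"
    using young_diagram_down[OF L, of "Suc i" j i j] by auto
  ultimately show ?R
    using assms(2) by (auto simp: m)
next
  assume R: ?R
  note m = mem_iff_less_row_length[OF assms(1)]
  have "(i', j') = (i, j)" if "(i', j') \<in> D" "i \<le> i'" "j \<le> j'" for i' j'
  proof -
    have "i' = i"
    proof (rule ccontr)
      assume "i' \<noteq> i"
      then have "(Suc i, j) \<in> D"
        using that by (intro young_diagram_down[OF assms(1) that(1)]) auto
      then show False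
        using R by (auto simp: m)
    qed
    then show ?thesis
      using R that by (auto simp: m)
  qed
  then have down: "(i2, j2) \<in> D - {(i, j)}" if "(i1, j1) \<in> D - {(i, j)}" "i2 \<le> i1" "j2 \<le> j1"
    for i1 j1 i2 j2
    using that young_diagram_down[OF assms(1), of i1 j1 i2 j2] by auto
  show ?L
    by (rule young_diagramI[OF _ down]) (use young_diagram_finite[OF assms(1)] in simp_all)
qed

lemma card_1_Diff_superset:
  assumes "D \<subseteq> E"
  shows "card (E - D) = 1 \<longleftrightarrow> (\<exists>c. c \<notin> D \<and> E = insert c D)"
proof
  assume "card (E - D) = 1"
  then obtain c where "E - D = {c}"
    using card_1_singletonE by blast
  then show "\<exists>c. c \<notin> D \<and> E = insert c D"
    using assms by (intro exI[of _ c]) blast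
next
  assume "\<exists>c. c \<notin> D \<and> E = insert c D"
  then obtain c where "c \<notin> D" "E = insert c D"
    by blast
  then have "E - D = {c}"
    by blast
  then show "card (E - D) = 1"
    by simp
qed

lemma upper_covers_eq:
  assumes "young_diagram D"
  shows "upper_covers D = (\<lambda>i. insert (i, row_length D i) D) `
           insert 0 (Suc ` {i. row_length D (Suc i) < row_length D i})"
    (is "_ = ?f ` ?R")
proof (intro set_eqI iffI)
  fix E assume E: "E \<in> upper_covers D"
  then have "\<exists>c. c \<notin> D \<and> E = insert c D"
    using card_1_Diff_superset[of D E] unfolding upper_covers_def by blast
  then obtain i j where ij: "(i, j) \<notin> D" "E = insert (i, j) D"
    by auto
  then have "j = row_length D i \<and> (i = 0 \<or> row_length D i < row_length D (i - 1))"
    using young_diagram_insert_iff[OF assms] E by (auto simp: upper_covers_def)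
  then show "E \<in> ?f ` ?R"
    using ij by (cases i) auto
next
  fix E assume "E \<in> ?f ` ?R"
  then obtain i where "i \<in> ?R" and E: "E = ?f i"
    by blast
  then have i: "i = 0 \<or> row_length D i < row_length D (i - 1)" "E = ?f i"
    by auto
  have n: "(i, row_length D i) \<notin> D"
    by (simp add: mem_iff_less_row_length[OF assms])
  then have "young_diagram E"
    using young_diagram_insert_iff[OF assms n] i by simp
  moreover have "card (E - D) = 1"
    using n i by (simp add: insert_Diff_if)
  ultimately show "E \<in> upper_covers D"
    using i by (auto simp: upper_covers_def)
qed

lemma lower_covers_eq:
  assumes "young_diagram D"
  shows "lower_covers D = (\<lambda>i. D - {(i, row_length D i - 1)}) `
           {i. row_length D (Suc i) < row_length D i}"
    (is "_ = ?f ` ?R")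
proof (intro set_eqI iffI)
  fix E assume E: "E \<in> lower_covers D"
  then have "\<exists>c. c \<notin> E \<and> D = insert c E"
    using card_1_Diff_superset[of E D] unfolding lower_covers_def by blast
  then obtain i j where ij: "(i, j) \<notin> E" "D = insert (i, j) E"
    by auto
  then have "E = D - {(i, j)}" "(i, j) \<in> D"
    by auto
  moreover have "Suc j = row_length D i \<and> row_length D (Suc i) < row_length D i"
    using young_diagram_remove_iff[OF assms \<open>(i, j) \<in> D\<close>] E \<open>E = D - {(i, j)}\<close>
    by (auto simp: lower_covers_def)
  ultimately show "E \<in> ?f ` ?R"
    by (intro image_eqI[of _ _ i]) auto
next
  fix E assume "E \<in> ?f ` ?R"
  then obtain i where i: "row_length D (Suc i) < row_length D i" "E = ?f i"
    by auto
  have n: "(i, row_length D i - 1) \<in> D"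
    using i by (simp add: mem_iff_less_row_length[OF assms])
  then have "young_diagram E"
    using young_diagram_remove_iff[OF assms n] i by simp
  moreover have "D - E = {(i, row_length D i - 1)}"
    using n i by blast
  ultimately show "E \<in> lower_covers D"
    using i by (auto simp: lower_covers_def)
qed

lemma finite_lower_covers: "young_diagram D \<Longrightarrow> finite (lower_covers D)"
  by (rule finite_subset[of _ "Pow D"]) (auto simp: lower_covers_def young_diagram_finite)

lemma finite_corner_rows:
  assumes "young_diagram D"
  shows "finite {i. row_length D (Suc i) < row_length D i}"
proof (rule finite_subset)
  show "{i. row_length D (Suc i) < row_length D i} \<subseteq> fst ` D"
  proof
    fix i assume "i \<in> {i. row_length D (Suc i) < row_length D i}"
    then have "(i, 0) \<in> D"
      by (simp add: mem_iff_less_row_length[OF assms])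
    then show "i \<in> fst ` D"
      by force
  qed
qed (use young_diagram_finite[OF assms] in simp)

lemma finite_upper_covers: "young_diagram D \<Longrightarrow> finite (upper_covers D)"
  by (simp add: upper_covers_eq finite_corner_rows)

text \<open>
  A row is strictly longer than the next one exactly if its last cell is removable, and also exactly if
  a cell can be added to that next row.  So the removable cells correspond to the addable cells
  outside the top row, and the top row contributes the extra one.
\<close>

lemma card_upper_covers:
  assumes "young_diagram D"
  shows "card (upper_covers D) = Suc (card (lower_covers D))"
proof -
  let ?R = "{i. row_length D (Suc i) < row_length D i}"
  have notin: "(i, row_length D i) \<notin> D" for i
    by (simp add: mem_iff_less_row_length[OF assms])
  have "card (upper_covers D) = card (insert 0 (Suc ` ?R))"
    unfolding upper_covers_eq[OF assms]
  proof (rule card_image, rule inj_onI)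
    fix i i' assume "insert (i, row_length D i) D = insert (i', row_length D i') D"
    then have "(i, row_length D i) \<in> insert (i', row_length D i') D"
      by blast
    then show "i = i'"
      using notin by blast
  qed
  also have "\<dots> = Suc (card ?R)"
    using finite_corner_rows[OF assms] by (simp add: card_image)
  also have "card ?R = card (lower_covers D)"
    unfolding lower_covers_eq[OF assms]
  proof (rule card_image[symmetric], rule inj_onI)
    fix i i' assume "i \<in> ?R" and eq: "D - {(i, row_length D i - 1)} = D - {(i', row_length D i' - 1)}"
    then have "(i, row_length D i - 1) \<in> D"
      by (simp add: mem_iff_less_row_length[OF assms])
    then show "i = i'"
      using eq by blast
  qed
  finally show ?thesis .
qed

lemma union_of_distinct_cocovers:
  assumes "D \<subseteq> E" "F \<subseteq> E" "card (E - D) = 1" "card (E - F) = 1" "D \<noteq> F"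
  shows "E = D \<union> F"
proof -
  obtain c where c: "E - D = {c}"
    using assms(3) by (rule card_1_singletonE)
  obtain d where d: "E - F = {d}"
    using assms(4) by (rule card_1_singletonE)
  have "D = E - {c}" "F = E - {d}" "c \<in> E"
    using c d assms(1,2) by blast+
  moreover from this have "c \<noteq> d"
    using assms(5) by blast
  ultimately show ?thesis
    by blast
qed

lemma inter_of_distinct_covers:
  assumes "G \<subseteq> D" "G \<subseteq> F" "card (D - G) = 1" "card (F - G) = 1" "D \<noteq> F"
  shows "G = D \<inter> F"
proof -
  obtain c where c: "D - G = {c}"
    using assms(3) by (rule card_1_singletonE)
  obtain d where d: "F - G = {d}"
    using assms(4) by (rule card_1_singletonE)
  have "D = insert c G" "F = insert d G" "c \<notin> G" "d \<notin> G"
    using c d assms(1,2) by blast+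
  moreover from this have "c \<noteq> d"
    using assms(5) by blast
  ultimately show ?thesis
    by blast
qed

text \<open>
  This is Stanley's relation \<open>DU - UD = I\<close>.  A diagram \<open>F\<close> different from \<open>D\<close> is reached from
  \<open>D\<close> by adding and then removing a cell in at most one way, through \<open>D \<union> F\<close>, and by removing and then
  adding in at most one way, through \<open>D \<inter> F\<close>; one way exists exactly if the other does.  The term
  \<open>F = D\<close> arises once for every addable cell on the left and once for every removable cell on the
  right, and the former are one more in number.
\<close>

lemma up_down_commutation:
  fixes g :: "(nat \<times> nat) set \<Rightarrow> nat"
  assumes D: "young_diagram D"
  shows "(\<Sum>E\<in>upper_covers D. \<Sum>F\<in>lower_covers E. g F) =
         (\<Sum>G\<in>lower_covers D. \<Sum>F\<in>upper_covers G. g F) + g D"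
proof -
  let ?up = "SIGMA E:upper_covers D. lower_covers E - {D}"
  let ?down = "SIGMA G:lower_covers D. upper_covers G - {D}"
  have yup: "young_diagram E" if "E \<in> upper_covers D" for E
    using that by (simp add: upper_covers_def)
  have ydown: "young_diagram E" if "E \<in> lower_covers D" for E
    using that by (simp add: lower_covers_def)
  have "(\<Sum>E\<in>upper_covers D. \<Sum>F\<in>lower_covers E. g F) =
        (\<Sum>E\<in>upper_covers D. g D + (\<Sum>F\<in>lower_covers E - {D}. g F))"
    using D by (intro sum.cong refl sum.remove finite_lower_covers)
      (auto simp: upper_covers_def lower_covers_def)
  also have "\<dots> = card (upper_covers D) * g D + (\<Sum>(E, F)\<in>?up. g F)"
    by (subst sum.Sigma[symmetric])
      (auto simp: sum.distrib finite_upper_covers D finite_lower_covers yup)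
  also have "(\<Sum>(E, F)\<in>?up. g F) = (\<Sum>(G, F)\<in>?down. g F)"
  proof (rule sum.reindex_bij_witness[where i = "\<lambda>(G, F). (D \<union> F, F)"
        and j = "\<lambda>(E, F). (D \<inter> F, F)"])
    fix p assume "p \<in> ?up"
    then obtain E F where p: "p = (E, F)" "young_diagram E" "young_diagram F" "D \<subseteq> E" "F \<subseteq> E"
      "card (E - D) = 1" "card (E - F) = 1" "F \<noteq> D"
      by (auto simp: upper_covers_def lower_covers_def)
    then have E: "E = D \<union> F"
      by (intro union_of_distinct_cocovers) auto
    show "(\<lambda>(G, F). (D \<union> F, F)) ((\<lambda>(E, F). (D \<inter> F, F)) p) = p"
      using p E by simp
    have "E - F = D - D \<inter> F" "E - D = F - D \<inter> F"
      using E by blast+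
    then have "card (D - D \<inter> F) = 1" "card (F - D \<inter> F) = 1"
      using p by simp_all
    then show "(\<lambda>(E, F). (D \<inter> F, F)) p \<in> ?down"
      using p D by (auto simp: upper_covers_def lower_covers_def young_diagram_Int)
    show "(case (\<lambda>(E, F). (D \<inter> F, F)) p of (G, F) \<Rightarrow> g F) = (case p of (E, F) \<Rightarrow> g F)"
      using p by simp
  next
    fix p assume "p \<in> ?down"
    then obtain G F where p: "p = (G, F)" "young_diagram G" "young_diagram F" "G \<subseteq> D" "G \<subseteq> F"
      "card (D - G) = 1" "card (F - G) = 1" "F \<noteq> D"
      by (auto simp: upper_covers_def lower_covers_def)
    then have G: "G = D \<inter> F"
      by (intro inter_of_distinct_covers) auto
    show "(\<lambda>(E, F). (D \<inter> F, F)) ((\<lambda>(G, F). (D \<union> F, F)) p) = p"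
      using p G by simp
    have "F - G = (D \<union> F) - D" "D - G = (D \<union> F) - F"
      using G by blast+
    then have "card ((D \<union> F) - D) = 1" "card ((D \<union> F) - F) = 1"
      using p by simp_all
    then show "(\<lambda>(G, F). (D \<union> F, F)) p \<in> ?up"
      using p D by (auto simp: upper_covers_def lower_covers_def young_diagram_Un)
  qed
  also have "card (upper_covers D) * g D + (\<Sum>(G, F)\<in>?down. g F) =
             g D + (card (lower_covers D) * g D + (\<Sum>(G, F)\<in>?down. g F))"
    by (simp add: card_upper_covers[OF D])
  also have "card (lower_covers D) * g D + (\<Sum>(G, F)\<in>?down. g F) =
             (\<Sum>G\<in>lower_covers D. g D + (\<Sum>F\<in>upper_covers G - {D}. g F))"
    by (subst sum.Sigma[symmetric])
      (auto simp: sum.distrib finite_upper_covers D finite_lower_covers ydown)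
  also have "\<dots> = (\<Sum>G\<in>lower_covers D. \<Sum>F\<in>upper_covers G. g F)"
    using D by (intro sum.cong refl sum.remove[symmetric] finite_upper_covers)
      (auto simp: upper_covers_def lower_covers_def)
  finally show ?thesis
    by simp
qed

section \<open>Growing and shrinking standard tableaux\<close>

text \<open>
  A standard filling of a diagram is a linear extension of the componentwise order on its cells.  With a
  single monotonicity condition instead of one for rows and one for columns, adding or deleting the
  largest entry needs no case distinction by direction.
\<close>

definition linear_extensions :: "(nat \<times> nat) set \<Rightarrow> (nat \<times> nat \<Rightarrow> nat) set" where
  "linear_extensions D = {T \<in> extensional D. bij_betw T D {1..card D} \<and>
     (\<forall>p\<in>D. \<forall>q\<in>D. fst p \<le> fst q \<and> snd p \<le> snd q \<and> p \<noteq> q \<longrightarrow> T p < T q)}"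

lemma finite_linear_extensions:
  assumes "finite D"
  shows "finite (linear_extensions D)"
proof (rule finite_subset)
  show "linear_extensions D \<subseteq> D \<rightarrow>\<^sub>E {1..card D}"
    by (auto simp: linear_extensions_def bij_betw_def PiE_def)
  show "finite (D \<rightarrow>\<^sub>E {1..card D})"
    using assms by (intro finite_PiE) auto
qed

lemma standard_tableaux_eq_linear_extensions:
  assumes "int_partition \<mu>"
  shows "standard_tableaux \<mu> = linear_extensions (diagram \<mu>)"
proof (intro set_eqI iffI)
  fix T assume T: "T \<in> standard_tableaux \<mu>"
  have row: "T (i, j) < T (i, j')" if "(i, j) \<in> diagram \<mu>" "(i, j') \<in> diagram \<mu>" "j < j'" for i j j'
    using T that unfolding standard_tableaux_def by blast
  have col: "T (i, j) < T (i', j)" if "(i, j) \<in> diagram \<mu>" "(i', j) \<in> diagram \<mu>" "i < i'" for i i' j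
    using T that unfolding standard_tableaux_def by blast
  have lt: "T (i, j) < T (i', j')"
    if "(i, j) \<in> diagram \<mu>" "(i', j') \<in> diagram \<mu>" "i \<le> i'" "j \<le> j'" "(i, j) \<noteq> (i', j')" for i j i' j'
  proof -
    \<comment> \<open>Walk from one cell to the other along a row and then down a column.\<close>
    have corner: "(i, j') \<in> diagram \<mu>"
      using young_diagram_down[OF young_diagram_diagram[OF assms], of i' j' i j'] that by simp
    show ?thesis
      using row[of i j j'] col[of i j' i'] corner that by (cases "i = i'"; cases "j = j'") auto
  qed
  have "T p < T q"
    if "p \<in> diagram \<mu>" "q \<in> diagram \<mu>" "fst p \<le> fst q" "snd p \<le> snd q" "p \<noteq> q" for p q
    using lt[of "fst p" "snd p" "fst q" "snd q"] that by simp
  then show "T \<in> linear_extensions (diagram \<mu>)"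
    using T unfolding linear_extensions_def standard_tableaux_def card_diagram by blast
next
  fix T assume T: "T \<in> linear_extensions (diagram \<mu>)"
  then have "T p < T q" if "p \<in> diagram \<mu>" "q \<in> diagram \<mu>" "fst p \<le> fst q" "snd p \<le> snd q" "p \<noteq> q" for p q
    using that unfolding linear_extensions_def by blast
  from this[of "(_, _)" "(_, _)"] show "T \<in> standard_tableaux \<mu>"
    using T unfolding linear_extensions_def standard_tableaux_def card_diagram by simp
qed

text \<open>
  The cell of the largest entry is maximal in the componentwise order, so the rest is again a diagram.
\<close>

lemma linear_extension_remove_max:
  assumes D: "young_diagram D" "D \<noteq> {}" and T: "T \<in> linear_extensions D"
  defines "E \<equiv> {p \<in> D. T p \<noteq> card D}"
  shows "E \<in> lower_covers D" and "restrict T E \<in> linear_extensions E"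
proof -
  have fin: "finite D"
    using D by (simp add: young_diagram_finite)
  have bij: "bij_betw T D {1..card D}"
    and inc: "\<And>p q. p \<in> D \<Longrightarrow> q \<in> D \<Longrightarrow> fst p \<le> fst q \<Longrightarrow> snd p \<le> snd q \<Longrightarrow> p \<noteq> q \<Longrightarrow> T p < T q"
    using T unfolding linear_extensions_def by blast+
  have "card D \<in> {1..card D}"
    using D fin by (simp add: Suc_le_eq card_gt_0_iff)
  then have "card D \<in> T ` D"
    using bij unfolding bij_betw_def by blast
  then obtain c where c: "c \<in> D" "T c = card D"
    by force
  have le: "T p \<le> card D" if "p \<in> D" for p
    using bij_betw_apply[OF bij that] by simp
  have "p = c" if "p \<in> D" "T p = card D" for p
    using inj_onD[OF bij_betw_imp_inj_on[OF bij], of p c] that c by simp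
  then have E: "E = D - {c}"
    using c unfolding E_def by blast
  have down: "(i', j') \<in> E" if "(i, j) \<in> E" "i' \<le> i" "j' \<le> j" for i j i' j'
  proof -
    have mem: "(i, j) \<in> D" "(i', j') \<in> D" "(i, j) \<noteq> c"
      using that young_diagram_down[OF D(1), of i j i' j'] by (auto simp: E)
    have "(i', j') \<noteq> c"
    proof
      assume "(i', j') = c"
      then have "T c < T (i, j)"
        using inc[of c "(i, j)"] mem that by auto
      then show False
        using le[OF mem(1)] c by simp
    qed
    then show ?thesis
      using mem by (simp add: E)
  qed
  have "young_diagram E"
    by (rule young_diagramI[OF _ down]) (use fin in \<open>simp_all add: E\<close>)
  moreover have "D - E = {c}"
    using c by (auto simp: E)
  ultimately show "E \<in> lower_covers D"
    by (simp add: lower_covers_def E Diff_subset)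
  have cardE: "card E = card D - 1"
    using c fin by (simp add: E)
  have "T ` E = T ` D - T ` {c}"
    unfolding E using inj_on_image_set_diff[OF bij_betw_imp_inj_on[OF bij]] c by blast
  also have "\<dots> = {1..card E}"
    using bij c cardE unfolding bij_betw_def by auto
  finally have "bij_betw T E {1..card E}"
    using inj_on_subset[OF bij_betw_imp_inj_on[OF bij]] by (simp add: bij_betw_def E)
  then have "bij_betw (restrict T E) E {1..card E}"
    using bij_betw_cong[of E "restrict T E" T] by simp
  then show "restrict T E \<in> linear_extensions E"
    using inc by (auto simp: linear_extensions_def E)
qed

lemma linear_extension_add_max:
  assumes D: "young_diagram D" and E: "E \<in> lower_covers D" and T: "T \<in> linear_extensions E"
  defines "T' \<equiv> \<lambda>p. if p \<in> D - E then card D else T p"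
  shows "T' \<in> linear_extensions D" and "{p \<in> D. T' p \<noteq> card D} = E" and "restrict T' E = T"
proof -
  have "card (D - E) = 1" "E \<subseteq> D" and yE: "young_diagram E"
    using E by (auto simp: lower_covers_def)
  then obtain c where DE: "D - E = {c}"
    by (metis card_1_singletonE)
  have c: "D = insert c E" "c \<notin> E"
    using DE \<open>E \<subseteq> D\<close> by blast+
  have ext: "T \<in> extensional E" and bij: "bij_betw T E {1..card E}"
    and inc: "\<And>p q. p \<in> E \<Longrightarrow> q \<in> E \<Longrightarrow> fst p \<le> fst q \<Longrightarrow> snd p \<le> snd q \<Longrightarrow> p \<noteq> q \<Longrightarrow> T p < T q"
    using T unfolding linear_extensions_def by blast+
  have cardD: "card D = Suc (card E)"
    using c young_diagram_finite[OF yE] by simp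
  have T': "T' = T(c := card D)"
    unfolding T'_def DE by auto
  have le: "T p < card D" if "p \<in> E" for p
    using bij_betw_apply[OF bij that] cardD by simp
  have "bij_betw T' E {1..card E}"
    using bij c by (subst bij_betw_cong[of E T' T]) (auto simp: T')
  moreover have "T' c \<notin> {1..card E}"
    using cardD by (simp add: T')
  ultimately have "bij_betw T' (insert c E) (insert (T' c) {1..card E})"
    using notIn_Un_bij_betw[OF c(2), of T' "{1..card E}"] by simp
  moreover have "insert (T' c) {1..card E} = {1..card D}"
    by (auto simp: T' cardD)
  ultimately have "bij_betw T' D {1..card D}"
    using c by simp
  moreover have "T' p < T' q"
    if "p \<in> D" "q \<in> D" "fst p \<le> fst q" "snd p \<le> snd q" "p \<noteq> q" for p q
  proof (cases "p = c")
    case True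
    then have "q \<in> E"
      using that c by auto
    then have "p \<in> E"
      using young_diagram_down[OF yE, of "fst q" "snd q" "fst p" "snd p"] that by simp
    then show ?thesis
      using True c by simp
  next
    case False
    then show ?thesis
      using that c le[of p] inc[of p q] by (auto simp: T')
  qed
  moreover have "T' \<in> extensional D"
    using ext c by (auto simp: T' extensional_def)
  ultimately show "T' \<in> linear_extensions D"
    by (simp add: linear_extensions_def)
  show "{p \<in> D. T' p \<noteq> card D} = E"
    using c less_imp_neq[OF le] by (auto simp: T')
  show "restrict T' E = T"
    using ext c by (auto simp: T' extensional_def restrict_def)
qed

text \<open>
  Deleting the cell with the largest entry is undone by putting that entry on the missing cell.
\<close>

lemma card_linear_extensions_shrink:
  assumes D: "young_diagram D" "D \<noteq> {}"
  shows "card (linear_extensions D) = (\<Sum>E\<in>lower_covers D. card (linear_extensions E))"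
proof -
  let ?shrink = "\<lambda>T. ({p \<in> D. T p \<noteq> card D}, restrict T {p \<in> D. T p \<noteq> card D})"
  let ?grow = "\<lambda>(E, T) p. if p \<in> D - E then card D else T p"
  have inverse: "?grow (?shrink T) = T" if "T \<in> linear_extensions D" for T
    using that by (auto simp: linear_extensions_def extensional_def)
  have "bij_betw ?shrink (linear_extensions D) (SIGMA E:lower_covers D. linear_extensions E)"
  proof (rule bij_betw_byWitness[where f' = ?grow])
    show "\<forall>T\<in>linear_extensions D. ?grow (?shrink T) = T"
      using inverse by blast
    show "\<forall>p\<in>Sigma (lower_covers D) linear_extensions. ?shrink (?grow p) = p"
    proof
      fix p assume "p \<in> Sigma (lower_covers D) linear_extensions"
      then obtain E T where p: "p = (E, T)" "E \<in> lower_covers D" "T \<in> linear_extensions E"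
        by blast
      show "?shrink (?grow p) = p"
        using linear_extension_add_max(2,3)[OF D(1) p(2,3)] by (simp only: p prod.case)
    qed
    show "?shrink ` linear_extensions D \<subseteq> Sigma (lower_covers D) linear_extensions"
      using linear_extension_remove_max[OF D] by auto
    show "?grow ` Sigma (lower_covers D) linear_extensions \<subseteq> linear_extensions D"
      using linear_extension_add_max(1)[OF D(1)] by auto
  qed
  then have "card (linear_extensions D) = card (SIGMA E:lower_covers D. linear_extensions E)"
    by (rule bij_betw_same_card)
  also have "\<dots> = (\<Sum>E\<in>lower_covers D. card (linear_extensions E))"
    using D by (intro card_SigmaI finite_lower_covers ballI finite_linear_extensions)
      (auto simp: lower_covers_def young_diagram_finite)
  finally show ?thesis .
qed

lemma lower_covers_empty: "lower_covers {} = {}"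
  by (simp add: lower_covers_def)

lemma card_lower_cover:
  assumes "young_diagram D" "E \<in> lower_covers D"
  shows "card D = Suc (card E)"
proof -
  have "D = (D - E) \<union> E" "card (D - E) = 1" "finite D"
    using assms by (auto simp: lower_covers_def young_diagram_finite)
  then show ?thesis
    using assms(2) card_Diff_subset[of E D] card_mono[of D E] finite_subset[of E D]
    by (auto simp: lower_covers_def)
qed

text \<open>
  By induction on the size \<open>n\<close> of \<open>D\<close>.  Expanding every upper cover by the branching rule and
  applying the commutation relation leaves the upper covers of the lower covers of \<open>D\<close>, for which the
  induction hypothesis yields the factor \<open>n\<close>; a second use of the branching rule gives
  \<open>n * f D + f D\<close>.  The branching rule itself fails for the empty diagram, but multiplied by
  \<open>n = 0\<close> it holds there too.
\<close>

lemma card_linear_extensions_grow: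
  assumes "young_diagram D"
  shows "(\<Sum>E\<in>upper_covers D. card (linear_extensions E)) = Suc (card D) * card (linear_extensions D)"
  using assms
proof (induction "card D" arbitrary: D rule: less_induct)
  case less
  let ?f = "\<lambda>E. card (linear_extensions E)"
  have "(\<Sum>E\<in>upper_covers D. ?f E) = (\<Sum>E\<in>upper_covers D. \<Sum>F\<in>lower_covers E. ?f F)"
  proof (rule sum.cong)
    fix E assume "E \<in> upper_covers D"
    then have "young_diagram E" "E \<noteq> {}"
      by (auto simp: upper_covers_def)
    then show "?f E = (\<Sum>F\<in>lower_covers E. ?f F)"
      by (rule card_linear_extensions_shrink)
  qed simp
  also have "\<dots> = (\<Sum>G\<in>lower_covers D. \<Sum>F\<in>upper_covers G. ?f F) + ?f D"
    using less.prems by (rule up_down_commutation)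
  also have "(\<Sum>G\<in>lower_covers D. \<Sum>F\<in>upper_covers G. ?f F) = (\<Sum>G\<in>lower_covers D. card D * ?f G)"
  proof (rule sum.cong)
    fix G assume G: "G \<in> lower_covers D"
    have "card D = Suc (card G)" "young_diagram G"
      using card_lower_cover[OF less.prems G] G by (auto simp: lower_covers_def)
    then show "(\<Sum>F\<in>upper_covers G. ?f F) = card D * ?f G"
      using less.hyps[of G] by simp
  qed simp
  also have "\<dots> = card D * ?f D"
  proof (cases "D = {}")
    case False
    then show ?thesis
      using card_linear_extensions_shrink[OF less.prems] by (simp add: sum_distrib_left)
  qed (simp add: lower_covers_empty)
  finally show ?case
    by simp
qed

section \<open>The weighted count of vacillating tableaux\<close>

definition added :: "nat list \<Rightarrow> nat list set" where
  "added \<nu> = {\<mu>. int_partition \<mu> \<and> contained \<nu> \<mu> \<and> skew_size \<mu> \<nu> = 1}"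

definition removed :: "nat list \<Rightarrow> nat list set" where
  "removed \<mu> = {\<nu>. int_partition \<nu> \<and> contained \<nu> \<mu> \<and> skew_size \<mu> \<nu> = 1}"

definition kept_or_removed :: "nat list \<Rightarrow> nat list set" where
  "kept_or_removed \<mu> = {\<nu>. int_partition \<nu> \<and> contained \<nu> \<mu> \<and> skew_size \<mu> \<nu> \<in> {0, 1}}"

lemma bij_betw_added: "bij_betw diagram (added \<nu>) (upper_covers (diagram \<nu>))"
  by (rule bij_betw_diagram)
    (auto simp: added_def upper_covers_def contained_def skew_size_def young_diagram_diagram)

lemma bij_betw_removed: "bij_betw diagram (removed \<mu>) (lower_covers (diagram \<mu>))"
  by (rule bij_betw_diagram)
    (auto simp: removed_def lower_covers_def contained_def skew_size_def young_diagram_diagram)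

lemma num_SYT_eq: "int_partition \<mu> \<Longrightarrow> num_SYT \<mu> = card (linear_extensions (diagram \<mu>))"
  by (simp add: num_SYT_def standard_tableaux_eq_linear_extensions)

lemma sum_num_SYT_added:
  assumes "int_partition \<nu>"
  shows "(\<Sum>\<mu>\<in>added \<nu>. num_SYT \<mu>) = Suc (sum_list \<nu>) * num_SYT \<nu>"
proof -
  have "(\<Sum>\<mu>\<in>added \<nu>. num_SYT \<mu>) = (\<Sum>\<mu>\<in>added \<nu>. card (linear_extensions (diagram \<mu>)))"
    by (rule sum.cong) (auto simp: added_def num_SYT_eq)
  also have "\<dots> = (\<Sum>D\<in>upper_covers (diagram \<nu>). card (linear_extensions D))"
    by (rule sum.reindex_bij_betw[OF bij_betw_added])
  also have "\<dots> = Suc (sum_list \<nu>) * num_SYT \<nu>"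
    using assms
    by (simp add: card_linear_extensions_grow young_diagram_diagram num_SYT_eq card_diagram)
  finally show ?thesis .
qed

lemma sum_num_SYT_removed:
  assumes "int_partition \<mu>" "\<mu> \<noteq> []"
  shows "(\<Sum>\<nu>\<in>removed \<mu>. num_SYT \<nu>) = num_SYT \<mu>"
proof -
  have "diagram [] = {}" "int_partition []"
    by (simp_all add: diagram_def int_partition_def)
  then have "diagram \<mu> \<noteq> {}"
    using inj_onD[OF inj_on_diagram, of \<mu> "[]"] assms by auto
  have "(\<Sum>\<nu>\<in>removed \<mu>. num_SYT \<nu>) = (\<Sum>\<nu>\<in>removed \<mu>. card (linear_extensions (diagram \<nu>)))"
    by (rule sum.cong) (auto simp: removed_def num_SYT_eq)
  also have "\<dots> = (\<Sum>D\<in>lower_covers (diagram \<mu>). card (linear_extensions D))"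
    by (rule sum.reindex_bij_betw[OF bij_betw_removed])
  also have "\<dots> = num_SYT \<mu>"
    using card_linear_extensions_shrink[OF young_diagram_diagram[OF assms(1)] \<open>diagram \<mu> \<noteq> {}\<close>] assms
    by (simp add: num_SYT_eq)
  finally show ?thesis .
qed

lemma num_SYT_Nil: "num_SYT [] = 1"
proof -
  have "standard_tableaux [] = {\<lambda>_. undefined}"
    by (auto simp: standard_tableaux_def diagram_def bij_betw_def)
  then show ?thesis
    by (simp add: num_SYT_def)
qed

lemma finite_added: "int_partition \<nu> \<Longrightarrow> finite (added \<nu>)"
  using bij_betw_finite[OF bij_betw_added] finite_upper_covers young_diagram_diagram by blast

lemma finite_removed: "int_partition \<mu> \<Longrightarrow> finite (removed \<mu>)"
  using bij_betw_finite[OF bij_betw_removed] finite_lower_covers young_diagram_diagram by blast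

lemma sum_list_added:
  assumes "int_partition \<nu>" "\<mu> \<in> added \<nu>"
  shows "sum_list \<mu> = Suc (sum_list \<nu>)"
proof -
  have "diagram \<nu> \<in> lower_covers (diagram \<mu>)" "young_diagram (diagram \<mu>)"
    using assms
    by (auto simp: added_def lower_covers_def contained_def skew_size_def young_diagram_diagram)
  then show ?thesis
    using card_lower_cover[of "diagram \<mu>" "diagram \<nu>"] by (simp add: card_diagram)
qed

lemma sum_list_removed:
  assumes "int_partition \<mu>" "\<nu> \<in> removed \<mu>"
  shows "sum_list \<mu> = Suc (sum_list \<nu>)"
proof -
  have "\<mu> \<in> added \<nu>" "int_partition \<nu>"
    using assms by (auto simp: added_def removed_def)
  then show ?thesis
    using sum_list_added by blast
qed

lemma kept_or_removed_eq:
  assumes "int_partition \<mu>"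
  shows "kept_or_removed \<mu> = insert \<mu> (removed \<mu>)"
proof -
  have zero: "skew_size \<mu> \<nu> = 0 \<longleftrightarrow> \<nu> = \<mu>" if "int_partition \<nu>" "contained \<nu> \<mu>" for \<nu>
  proof -
    have "skew_size \<mu> \<nu> = 0 \<longleftrightarrow> diagram \<nu> = diagram \<mu>"
      using that(2) finite_diagram[of \<mu>] by (auto simp: skew_size_def contained_def)
    then show ?thesis
      using inj_onD[OF inj_on_diagram, of \<nu> \<mu>] that assms by auto
  qed
  have "contained \<mu> \<mu>"
    by (simp add: contained_def)
  with zero assms show ?thesis
    by (auto simp: kept_or_removed_def removed_def)
qed

lemma not_mem_removed: "\<mu> \<notin> removed \<mu>"
  by (simp add: removed_def skew_size_def)

text \<open>
  How the weight \<open>f\<close> spreads in one full step from \<open>\<mu>\<close>.  Keeping \<open>\<mu>\<close> and adding a cell raises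
  the size by one and multiplies the weight by the new size.  Removing a cell of a non-empty \<open>\<mu>\<close> preserves the
  total weight, and adding one then returns to the old size and multiplies by that size.  In both cases
  the factor is the size at the end of the step.
\<close>

lemma sum_one_step:
  assumes "int_partition \<mu>"
  shows "(\<Sum>\<nu>\<in>kept_or_removed \<mu>. \<Sum>\<rho>\<in>added \<nu>. if sum_list \<rho> = Suc m then num_SYT \<rho> else 0) =
    Suc m * ((if sum_list \<mu> = m then num_SYT \<mu> else 0) +
             (if sum_list \<mu> = Suc m then num_SYT \<mu> else 0))"
proof -
  have up: "(\<Sum>\<rho>\<in>added \<nu>. if sum_list \<rho> = Suc m then num_SYT \<rho> else 0) =
    Suc m * (if sum_list \<nu> = m then num_SYT \<nu> else 0)" if "int_partition \<nu>" for \<nu>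
  proof -
    have "(\<Sum>\<rho>\<in>added \<nu>. if sum_list \<rho> = Suc m then num_SYT \<rho> else 0) =
          (\<Sum>\<rho>\<in>added \<nu>. if sum_list \<nu> = m then num_SYT \<rho> else 0)"
      using sum_list_added[OF that] by (intro sum.cong) auto
    then show ?thesis
      using sum_num_SYT_added[OF that] by auto
  qed
  have "(\<Sum>\<nu>\<in>kept_or_removed \<mu>. \<Sum>\<rho>\<in>added \<nu>. if sum_list \<rho> = Suc m then num_SYT \<rho> else 0) =
        (\<Sum>\<nu>\<in>kept_or_removed \<mu>. Suc m * (if sum_list \<nu> = m then num_SYT \<nu> else 0))"
    by (intro sum.cong refl up) (simp add: kept_or_removed_def)
  also have "\<dots> = Suc m * ((if sum_list \<mu> = m then num_SYT \<mu> else 0) +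
      (\<Sum>\<nu>\<in>removed \<mu>. if sum_list \<nu> = m then num_SYT \<nu> else 0))"
    by (simp only: kept_or_removed_eq[OF assms] sum_distrib_left[symmetric]
        sum.insert[OF finite_removed[OF assms] not_mem_removed])
  also have "(\<Sum>\<nu>\<in>removed \<mu>. if sum_list \<nu> = m then num_SYT \<nu> else 0) =
             (\<Sum>\<nu>\<in>removed \<mu>. if sum_list \<mu> = Suc m then num_SYT \<nu> else 0)"
    using sum_list_removed[OF assms] by (intro sum.cong) auto
  also have "\<dots> = (if sum_list \<mu> = Suc m then num_SYT \<mu> else 0)"
    using sum_num_SYT_removed[OF assms] by (cases "\<mu> = []") simp_all
  finally show ?thesis .
qed

text \<open>
  The limiting vacillating tableaux of length \<open>2 * k\<close> and arbitrary shape.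
\<close>

definition lvts :: "nat \<Rightarrow> nat list list set" where
  "lvts k = {t. t \<in> limiting_vacillating_tableaux k (t ! (2 * k))}"

lemma lvts_iff:
  "t \<in> lvts k \<longleftrightarrow> length t = 2 * k + 1 \<and> (\<forall>\<nu>\<in>set t. int_partition \<nu>) \<and> t ! 0 = [] \<and>
     (\<forall>j<k. t ! (2 * j + 1) \<in> kept_or_removed (t ! (2 * j)) \<and>
            t ! (2 * j + 2) \<in> added (t ! (2 * j + 1)))"
proof -
  have "int_partition (t ! (2 * j + 1))" "int_partition (t ! (2 * j + 2))"
    if "length t = 2 * k + 1" "\<forall>\<nu>\<in>set t. int_partition \<nu>" "j < k" for j
    using that by simp_all
  then show ?thesis
    unfolding lvts_def limiting_vacillating_tableaux_def kept_or_removed_def added_def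
    by (simp only: mem_Collect_eq) blast
qed

lemma int_partition_final_shape: "t \<in> lvts k \<Longrightarrow> int_partition (t ! (2 * k))"
  by (simp add: lvts_iff)

lemma lvts_0: "lvts 0 = {[[]]}"
  by (auto simp: lvts_iff int_partition_def length_Suc_conv)

lemma lvts_Suc:
  "lvts (Suc k) = (\<lambda>(t, \<nu>, \<mu>). t @ [\<nu>, \<mu>]) `
     (SIGMA t:lvts k. SIGMA \<nu>:kept_or_removed (t ! (2 * k)). added \<nu>)"
    (is "_ = ?f ` ?A")
proof (intro set_eqI iffI)
  fix t assume t: "t \<in> lvts (Suc k)"
  let ?s = "take (2 * k + 1) t"
  have len: "length t = 2 * k + 3"
    using t by (simp add: lvts_iff)
  have eq: "t = ?s @ [t ! (2 * k + 1), t ! (2 * k + 2)]"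
  proof (rule nth_equalityI)
    fix i assume "i < length t"
    then consider "i < 2 * k + 1" | "i = 2 * k + 1" | "i = 2 * k + 2"
      using len by linarith
    then show "t ! i = (?s @ [t ! (2 * k + 1), t ! (2 * k + 2)]) ! i"
      using len by cases (simp_all add: nth_append)
  qed (simp add: len)
  have "?s \<in> lvts k"
    using t len by (auto simp: lvts_iff dest: in_set_takeD)
  moreover have "t ! (2 * k + 1) \<in> kept_or_removed (?s ! (2 * k))"
    "t ! (2 * k + 2) \<in> added (t ! (2 * k + 1))"
    using t by (auto simp: lvts_iff)
  ultimately have "(?s, t ! (2 * k + 1), t ! (2 * k + 2)) \<in> ?A"
    by blast
  then show "t \<in> ?f ` ?A"
    using eq by (intro image_eqI[of _ _ "(?s, t ! (2 * k + 1), t ! (2 * k + 2))"]) simp_all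
next
  fix t assume "t \<in> ?f ` ?A"
  then obtain s \<nu> \<mu> where t: "t = s @ [\<nu>, \<mu>]"
    and s: "s \<in> lvts k" and \<nu>: "\<nu> \<in> kept_or_removed (s ! (2 * k))" and \<mu>: "\<mu> \<in> added \<nu>"
    by auto
  have len: "length s = 2 * k + 1"
    using s by (simp add: lvts_iff)
  have "t ! (2 * j + 1) \<in> kept_or_removed (t ! (2 * j)) \<and> t ! (2 * j + 2) \<in> added (t ! (2 * j + 1))"
    if "j < Suc k" for j
  proof (cases "j = k")
    case True
    then show ?thesis
      using \<nu> \<mu> len by (simp add: t nth_append)
  next
    case False
    then have "j < k"
      using that by simp
    then show ?thesis
      using s len by (simp add: t nth_append lvts_iff)
  qed
  moreover have "int_partition \<nu>" "int_partition \<mu>"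
    using \<nu> \<mu> by (simp_all add: kept_or_removed_def added_def)
  ultimately show "t \<in> lvts (Suc k)"
    using s len unfolding lvts_iff[of t] by (auto simp: lvts_iff t nth_append)
qed

lemma inj_on_extend: "inj_on (\<lambda>(t, \<nu>, \<mu>). t @ [\<nu>, \<mu>]) A"
  by (auto simp: inj_on_def)

lemma finite_kept_or_removed: "int_partition \<mu> \<Longrightarrow> finite (kept_or_removed \<mu>)"
  by (simp add: kept_or_removed_eq finite_removed)

lemma int_partition_kept_or_removed: "\<nu> \<in> kept_or_removed \<mu> \<Longrightarrow> int_partition \<nu>"
  by (simp add: kept_or_removed_def)

lemma finite_lvts: "finite (lvts k)"
proof (induction k)
  case (Suc k)
  then show ?case
    unfolding lvts_Suc
    by (intro finite_imageI finite_SigmaI finite_kept_or_removed finite_added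
        int_partition_final_shape int_partition_kept_or_removed)
qed (simp add: lvts_0)

text \<open>
  Here \<open>h\<close> is an arbitrary weight on the final shape; it will be the number of standard tableaux,
  restricted to one size.
\<close>

lemma sum_lvts_Suc:
  "(\<Sum>t\<in>lvts (Suc k). h (t ! (2 * Suc k))) =
   (\<Sum>t\<in>lvts k. \<Sum>\<nu>\<in>kept_or_removed (t ! (2 * k)). \<Sum>\<mu>\<in>added \<nu>. h \<mu>)"
proof -
  let ?A = "SIGMA t:lvts k. SIGMA \<nu>:kept_or_removed (t ! (2 * k)). added \<nu>"
  have "(\<Sum>t\<in>lvts (Suc k). h (t ! (2 * Suc k))) =
        (\<Sum>(t, \<nu>, \<mu>)\<in>?A. h ((t @ [\<nu>, \<mu>]) ! (2 * Suc k)))"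
    unfolding lvts_Suc by (subst sum.reindex[OF inj_on_extend]) (simp add: case_prod_unfold)
  also have "\<dots> = (\<Sum>(t, \<nu>, \<mu>)\<in>?A. h \<mu>)"
    by (intro sum.cong) (auto simp: nth_append lvts_iff)
  also have "\<dots> = (\<Sum>t\<in>lvts k. \<Sum>(\<nu>, \<mu>)\<in>(SIGMA \<nu>:kept_or_removed (t ! (2 * k)). added \<nu>). h \<mu>)"
    by (rule sum.Sigma[symmetric])
      (auto intro!: finite_lvts finite_kept_or_removed finite_added
        int_partition_final_shape intro: int_partition_kept_or_removed)
  also have "\<dots> = (\<Sum>t\<in>lvts k. \<Sum>\<nu>\<in>kept_or_removed (t ! (2 * k)). \<Sum>\<mu>\<in>added \<nu>. h \<mu>)"
    by (rule sum.cong[OF refl], rule sum.Sigma[symmetric])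
      (auto intro!: finite_kept_or_removed finite_added
        int_partition_final_shape intro: int_partition_kept_or_removed)
  finally show ?thesis .
qed

text \<open>
  Let \<open>A k n\<close> be the left-hand side.  One step gives
  \<open>A (k + 1) n = n * A k (n - 1) + n * A k n\<close>, which is the recurrence for the Stirling numbers of
  the second kind multiplied by \<open>fact n\<close>.
\<close>

lemma weighted_lvts_of_size:
  "(\<Sum>t\<in>lvts k. if sum_list (t ! (2 * k)) = n then num_SYT (t ! (2 * k)) else 0) =
     fact n * Stirling k n"
proof (induction k arbitrary: n)
  case 0
  show ?case
    by (cases n) (simp_all add: lvts_0 num_SYT_Nil)
next
  case (Suc k)
  let ?w = "\<lambda>n \<mu>. if sum_list \<mu> = n then num_SYT \<mu> else 0"
  show ?case
  proof (cases n)
    case 0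
    have "?w 0 \<rho> = 0" if "\<nu> \<in> kept_or_removed \<mu>" "\<rho> \<in> added \<nu>" for \<mu> \<nu> \<rho>
      using sum_list_added[OF int_partition_kept_or_removed[OF that(1)] that(2)] by simp
    then show ?thesis
      unfolding sum_lvts_Suc[where h = "?w n"] by (simp add: 0)
  next
    case (Suc m)
    have "(\<Sum>t\<in>lvts (Suc k). ?w n (t ! (2 * Suc k))) =
      (\<Sum>t\<in>lvts k. Suc m * (?w m (t ! (2 * k)) + ?w (Suc m) (t ! (2 * k))))"
      unfolding Suc sum_lvts_Suc[where h = "?w (Suc m)"]
      by (intro sum.cong refl sum_one_step int_partition_final_shape)
    also have "\<dots> = Suc m * (fact m * Stirling k m + fact (Suc m) * Stirling k (Suc m))"
      by (simp only: sum_distrib_left[symmetric] sum.distrib Suc.IH)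
    also have "\<dots> = fact n * Stirling (Suc k) n"
      by (simp add: Suc algebra_simps)
    finally show ?thesis .
  qed
qed

text \<open>
  Needed to cut the sum over all sizes down to \<open>{..k}\<close>.
\<close>

lemma sum_list_final_shape_le: "t \<in> lvts k \<Longrightarrow> sum_list (t ! (2 * k)) \<le> k"
proof (induction k arbitrary: t)
  case 0
  then show ?case by (simp add: lvts_0)
next
  case (Suc k)
  then obtain s \<nu> \<mu> where t: "t = s @ [\<nu>, \<mu>]"
    and s: "s \<in> lvts k" and \<nu>: "\<nu> \<in> kept_or_removed (s ! (2 * k))" and \<mu>: "\<mu> \<in> added \<nu>"
    unfolding lvts_Suc by auto
  have "sum_list \<nu> \<le> sum_list (s ! (2 * k))"
    using \<nu> sum_list_removed[OF int_partition_final_shape[OF s]]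
    unfolding kept_or_removed_eq[OF int_partition_final_shape[OF s]] by fastforce
  then have "sum_list \<mu> \<le> Suc k"
    using Suc.IH[OF s] sum_list_added[OF int_partition_kept_or_removed[OF \<nu>] \<mu>] by simp
  moreover have "length s = 2 * k + 1"
    using s by (simp add: lvts_iff)
  ultimately show ?case
    by (simp add: t nth_append)
qed

text \<open>
  Grouping the tableaux by final shape; only the finitely many shapes that occur contribute, so the
  infinite sum is a finite one.
\<close>

lemma vac_sum_eq_sum_lvts: "vac_sum k = (\<Sum>t\<in>lvts k. num_SYT (t ! (2 * k)))"
proof -
  let ?shape = "\<lambda>t. t ! (2 * k)"
  have fibre: "{t \<in> lvts k. ?shape t = \<mu>} = limiting_vacillating_tableaux k \<mu>" for \<mu>
    by (auto simp: lvts_def limiting_vacillating_tableaux_def)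
  have "num_lvt k \<mu> = 0" if "\<mu> \<notin> ?shape ` lvts k" for \<mu>
  proof -
    have "{t \<in> lvts k. ?shape t = \<mu>} = {}"
      using that by blast
    then show ?thesis
      by (simp add: num_lvt_def fibre)
  qed
  then have "vac_sum k = (\<Sum>\<^sub>\<infinity>\<mu>\<in>?shape ` lvts k. num_lvt k \<mu> * num_SYT \<mu>)"
    unfolding vac_sum_def
    by (intro infsum_cong_neutral) (auto simp: int_partition_final_shape)
  also have "\<dots> = (\<Sum>\<mu>\<in>?shape ` lvts k. num_lvt k \<mu> * num_SYT \<mu>)"
    by (simp add: finite_lvts)
  also have "\<dots> = (\<Sum>\<mu>\<in>?shape ` lvts k. \<Sum>t\<in>{t \<in> lvts k. ?shape t = \<mu>}. num_SYT (?shape t))"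
    by (intro sum.cong) (simp_all add: num_lvt_def flip: fibre)
  also have "\<dots> = (\<Sum>t\<in>lvts k. num_SYT (?shape t))"
    by (rule sum.image_gen[symmetric]) (rule finite_lvts)
  finally show ?thesis .
qed

lemma vac_sum_eq_sum_Stirling: "vac_sum k = (\<Sum>n\<le>k. fact n * Stirling k n)"
proof -
  let ?shape = "\<lambda>t. t ! (2 * k)"
  have "vac_sum k = (\<Sum>t\<in>lvts k. \<Sum>n\<le>k. if sum_list (?shape t) = n then num_SYT (?shape t) else 0)"
    unfolding vac_sum_eq_sum_lvts by (intro sum.cong) (auto simp: sum_list_final_shape_le)
  also have "\<dots> = (\<Sum>n\<le>k. fact n * Stirling k n)"
    by (subst sum.swap) (simp only: weighted_lvts_of_size)
  finally show ?thesis .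
qed

section \<open>Counting ordered set partitions\<close>

definition surjections :: "'a set \<Rightarrow> 'b set \<Rightarrow> ('a \<Rightarrow> 'b) set" where
  "surjections S B = {f \<in> extensional S. f ` S = B}"

lemma finite_surjections:
  assumes "finite S" "finite B"
  shows "finite (surjections S B)"
proof (rule finite_subset)
  show "surjections S B \<subseteq> S \<rightarrow>\<^sub>E B"
    by (auto simp: surjections_def PiE_def)
  show "finite (S \<rightarrow>\<^sub>E B)"
    using assms by (simp add: finite_PiE)
qed

text \<open>
  A surjection from \<open>insert x S\<close> restricts to a map on \<open>S\<close> that misses at most the value at \<open>x\<close>.
\<close>

lemma surjections_insert:
  assumes "x \<notin> S"
  shows "surjections (insert x S) B =
    (\<Union>b\<in>B. (\<lambda>f. f(x := b)) ` (surjections S B \<union> surjections S (B - {b})))"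
proof (intro set_eqI iffI)
  fix f assume f: "f \<in> surjections (insert x S) B"
  let ?g = "f(x := undefined)"
  have img: "insert (f x) (f ` S) = B" and ext: "f \<in> extensional (insert x S)"
    using f by (auto simp: surjections_def)
  have "?g ` S = f ` S"
    using assms by (intro image_cong) auto
  moreover have "f ` S = B \<or> f ` S = B - {f x}"
    using img by blast
  moreover have "?g \<in> extensional S"
    using ext by (auto simp: extensional_def)
  ultimately have "?g \<in> surjections S B \<union> surjections S (B - {f x})"
    by (auto simp: surjections_def)
  moreover have "f = ?g(x := f x)"
    by simp
  moreover have "f x \<in> B"
    using img by blast
  ultimately show "f \<in> (\<Union>b\<in>B. (\<lambda>f. f(x := b)) ` (surjections S B \<union> surjections S (B - {b})))"
    by blast
next
  fix f assume "f \<in> (\<Union>b\<in>B. (\<lambda>f. f(x := b)) ` (surjections S B \<union> surjections S (B - {b})))"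
  then obtain b g where b: "b \<in> B" "f = g(x := b)" "g \<in> extensional S" "g ` S = B \<or> g ` S = B - {b}"
    by (auto simp: surjections_def)
  have "f ` S = g ` S"
    using assms b(2) by (intro image_cong) auto
  then have "f ` insert x S = B"
    using b by auto
  moreover have "f \<in> extensional (insert x S)"
    using b by (auto simp: extensional_def)
  ultimately show "f \<in> surjections (insert x S) B"
    by (simp add: surjections_def)
qed

text \<open>
  The decomposition above turns into
  \<open>n * (fact n * Stirling k n + fact (n - 1) * Stirling k (n - 1))\<close>, where \<open>n\<close> is the size of
  \<open>B\<close> and \<open>k\<close> that of \<open>S\<close>.
\<close>

lemma card_surjections:
  fixes S :: "'a set" and B :: "'b set"
  assumes "finite S" "finite B"
  shows "card (surjections S B) = fact (card B) * Stirling (card S) (card B)"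
  using assms
proof (induction S arbitrary: B rule: finite_induct)
  case empty
  show ?case
  proof (cases "B = {}")
    case True
    then have "surjections ({} :: 'a set) B = {\<lambda>_. undefined}"
      by (auto simp: surjections_def)
    then show ?thesis
      using True by simp
  next
    case False
    then have "surjections ({} :: 'a set) B = {}"
      by (auto simp: surjections_def)
    moreover have "card B = Suc (card B - 1)"
      using False empty.prems by (simp add: card_gt_0_iff)
    then have "Stirling 0 (card B) = 0"
      by (metis Stirling.simps(2))
    ultimately show ?thesis
      by simp
  qed
next
  case (insert x S)
  let ?F = "\<lambda>b. surjections S B \<union> surjections S (B - {b})"
  have inj: "inj_on (\<lambda>f. f(x := b)) (?F b)" for b :: 'b
  proof (rule inj_onI)
    fix f g assume fg: "f \<in> ?F b" "g \<in> ?F b" "f(x := b) = g(x := b)"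
    have "f x = undefined" "g x = undefined"
      using fg(1,2) insert.hyps(2) by (auto simp: surjections_def extensional_def)
    then show "f = g"
      using fg(3) by (metis fun_upd_triv fun_upd_upd)
  qed
  have "card (surjections (insert x S) B) = (\<Sum>b\<in>B. card ((\<lambda>f. f(x := b)) ` ?F b))"
    unfolding surjections_insert[OF insert.hyps(2)]
  proof (rule card_UN_disjoint)
    show "finite B" by fact
    show "\<forall>b\<in>B. finite ((\<lambda>f. f(x := b)) ` ?F b)"
      using insert by (simp add: finite_surjections)
    show "\<forall>b\<in>B. \<forall>b'\<in>B. b \<noteq> b' \<longrightarrow> (\<lambda>f. f(x := b)) ` ?F b \<inter> (\<lambda>f. f(x := b')) ` ?F b' = {}"
    proof (intro ballI impI)
      fix b b' :: 'b assume "b \<noteq> b'"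
      have val: "h x = d" if "h \<in> (\<lambda>f. f(x := d)) ` ?F d" for h d
        using that by (rule imageE) simp
      show "(\<lambda>f. f(x := b)) ` ?F b \<inter> (\<lambda>f. f(x := b')) ` ?F b' = {}"
      proof (rule equals0I)
        fix h assume "h \<in> (\<lambda>f. f(x := b)) ` ?F b \<inter> (\<lambda>f. f(x := b')) ` ?F b'"
        then show False
          using val[OF IntD1] val[OF IntD2] \<open>b \<noteq> b'\<close> by metis
      qed
    qed
  qed
  also have "\<dots> = (\<Sum>b\<in>B. fact (card B) * Stirling (card S) (card B) +
                       fact (card B - 1) * Stirling (card S) (card B - 1))"
  proof (rule sum.cong)
    fix b assume b: "b \<in> B"
    have "surjections S B \<inter> surjections S (B - {b}) = {}"
      using b by (auto simp: surjections_def)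
    then have "card (?F b) = card (surjections S B) + card (surjections S (B - {b}))"
      using insert by (simp add: card_Un_disjoint finite_surjections)
    then show "card ((\<lambda>f. f(x := b)) ` ?F b) = fact (card B) * Stirling (card S) (card B) +
                 fact (card B - 1) * Stirling (card S) (card B - 1)"
      using insert b by (simp add: card_image[OF inj])
  qed simp
  also have "\<dots> = fact (card B) * Stirling (card (insert x S)) (card B)"
    using insert.hyps by (cases "card B") (simp_all add: algebra_simps)
  finally show ?case .
qed

text \<open>
  An ordered set partition with \<open>n\<close> blocks is the list of fibres of the map that sends each element to
  the index of its block; that no block is empty means that this map is onto \<open>{..<n}\<close>.
\<close>

lemma ordered_set_partitions_eq_fibres:
  "{Bs \<in> ordered_set_partitions S. length Bs = n} =
     (\<lambda>f. map (\<lambda>i. {x \<in> S. f x = i}) [0..<n]) ` surjections S {..<n}"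
    (is "?P = ?fibres ` _")
proof (intro set_eqI iffI)
  fix Bs assume "Bs \<in> ?P"
  then have Bs: "distinct Bs" "partition_on S (set Bs)" "length Bs = n"
    by (auto simp: ordered_set_partitions_def)
  define f where "f = (\<lambda>x. if x \<in> S then SOME i. i < n \<and> x \<in> Bs ! i else undefined)"
  have S: "\<Union> (set Bs) = S"
    using Bs(2) by (simp add: partition_on_def)
  have f: "f x < n \<and> x \<in> Bs ! f x" if "x \<in> S" for x
  proof -
    have "x \<in> \<Union> (set Bs)"
      using S that by simp
    then obtain B where "B \<in> set Bs" "x \<in> B"
      by blast
    then have "\<exists>i. i < n \<and> x \<in> Bs ! i"
      using Bs(3) by (auto simp: in_set_conv_nth)
    then show ?thesis
      using someI_ex[of "\<lambda>i. i < n \<and> x \<in> Bs ! i"] that by (simp add: f_def)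
  qed
  have f_eq: "f x = i" and xS: "x \<in> S" if "i < n" "x \<in> Bs ! i" for i x
  proof -
    show xS: "x \<in> S"
      using S that Bs(3) nth_mem by blast
    have "Bs ! i \<in> set Bs" "Bs ! f x \<in> set Bs"
      using that Bs(3) f[OF xS] by simp_all
    moreover have "x \<in> Bs ! i \<inter> Bs ! f x"
      using that f[OF xS] by blast
    ultimately have "Bs ! i = Bs ! f x"
      using partition_onD2[OF Bs(2)] by (auto simp: disjoint_def)
    then show "f x = i"
      using Bs(1,3) f[OF xS] that(1) nth_eq_iff_index_eq by metis
  qed
  have fibre: "{x \<in> S. f x = i} = Bs ! i" if "i < n" for i
    using f f_eq[OF that] xS[OF that] by blast
  have "Bs = ?fibres f"
    using Bs(3) fibre by (intro nth_equalityI) auto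
  moreover have "f \<in> surjections S {..<n}"
  proof -
    have "i \<in> f ` S" if i: "i < n" for i
    proof -
      have "Bs ! i \<noteq> {}"
        using i Bs nth_mem[of i Bs] partition_onD3[OF Bs(2)] by metis
      then obtain x where "x \<in> S" "f x = i"
        using fibre[OF i] by blast
      then show ?thesis
        by blast
    qed
    then have "f ` S = {..<n}"
      using f by auto
    moreover have "f \<in> extensional S"
      by (simp add: f_def extensional_def)
    ultimately show ?thesis
      by (simp add: surjections_def)
  qed
  ultimately show "Bs \<in> ?fibres ` surjections S {..<n}"
    by blast
next
  fix Bs assume "Bs \<in> ?fibres ` surjections S {..<n}"
  then obtain f where f: "f ` S = {..<n}" and Bs: "Bs = ?fibres f"
    by (auto simp: surjections_def)
  have nonempty: "\<exists>x\<in>S. f x = i" if "i < n" for i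
    using f that by (metis imageE lessThan_iff)
  have "i = j" if "i < n" "{x \<in> S. f x = i} = {x \<in> S. f x = j}" for i j
    using nonempty[OF that(1)] that(2) by blast
  then have "distinct Bs"
    by (auto simp: Bs distinct_map inj_on_def)
  moreover have "partition_on S (set Bs)"
  proof (rule partition_onI)
    show "\<Union> (set Bs) = S"
      using f by (auto simp: Bs)
    show "disjnt p q" if "p \<in> set Bs" "q \<in> set Bs" "p \<noteq> q" for p q
      using that by (auto simp: Bs disjnt_def)
    show "{} \<notin> set Bs"
    proof
      assume "{} \<in> set Bs"
      then obtain i where "i < n" "{} = {x \<in> S. f x = i}"
        by (auto simp: Bs)
      then show False
        using nonempty[of i] by blast
    qed
  qed
  ultimately show "Bs \<in> ?P"
    by (simp add: ordered_set_partitions_def Bs)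
qed

lemma inj_on_fibres:
  "inj_on (\<lambda>f. map (\<lambda>i. {x \<in> S. f x = i}) [0..<n]) (surjections S {..<n})"
proof (rule inj_onI)
  fix f g assume fg: "f \<in> surjections S {..<n}" "g \<in> surjections S {..<n}"
    and eq: "map (\<lambda>i. {x \<in> S. f x = i}) [0..<n] = map (\<lambda>i. {x \<in> S. g x = i}) [0..<n]"
  have fibre: "{x \<in> S. f x = i} = {x \<in> S. g x = i}" if "i < n" for i
    using arg_cong[OF eq, of "\<lambda>Bs. Bs ! i"] that by simp
  show "f = g"
  proof (rule extensionalityI)
    show "f \<in> extensional S" "g \<in> extensional S"
      using fg by (auto simp: surjections_def)
    fix x assume "x \<in> S"
    then have "f x < n"
      using fg(1) by (auto simp: surjections_def)
    then have "x \<in> {y \<in> S. g y = f x}"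
      using fibre[of "f x"] \<open>x \<in> S\<close> by blast
    then show "f x = g x"
      by simp
  qed
qed

lemma card_ordered_set_partitions:
  assumes "finite S"
  shows "card (ordered_set_partitions S) = (\<Sum>n\<le>card S. fact n * Stirling (card S) n)"
proof -
  let ?P = "\<lambda>n. {Bs \<in> ordered_set_partitions S. length Bs = n}"
  have card: "card (?P n) = fact n * Stirling (card S) n" for n
    unfolding ordered_set_partitions_eq_fibres card_image[OF inj_on_fibres]
    using card_surjections[OF assms, of "{..<n}"] by simp
  have fin: "finite (?P n)" for n
    unfolding ordered_set_partitions_eq_fibres
    using assms by (simp add: finite_surjections)
  \<comment> \<open>The count itself excludes more blocks than elements: the Stirling number vanishes there.\<close>
  have "length Bs \<le> card S" if "Bs \<in> ordered_set_partitions S" for Bs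
  proof (rule ccontr)
    assume "\<not> ?thesis"
    then have "card (?P (length Bs)) = 0"
      by (simp only: card) simp
    then show False
      using fin[of "length Bs"] that by auto
  qed
  then have "ordered_set_partitions S = (\<Union>n\<le>card S. ?P n)"
    by auto
  then have "card (ordered_set_partitions S) = card (\<Union>n\<le>card S. ?P n)"
    by simp
  also have "\<dots> = (\<Sum>n\<le>card S. card (?P n))"
    using fin by (intro card_UN_disjoint) auto
  finally show ?thesis
    by (simp only: card)
qed

section \<open>The Fubini numbers\<close>

theorem theorem17:
  fixes k :: nat
  shows "vac_sum k = fubini k"
  by (simp add: vac_sum_eq_sum_Stirling fubini_def card_ordered_set_partitions)

end
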